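(* Let $T>0$, $\lambda>0$ and let $u_\lambda$ be a classical Ginzburg–Landau heat flow. For any numbers $t_1,t_2$ with $0\le t_1\le t_2\le T$, $$\int_{t_1}^{t_2}dt\int_{\mathbb{B}^d}\left|\frac{\partial u_\lambda}{\partial t}\right|^2dx+\int_{\mathbb{B}^d}\mathbf{e}_\lambda(t_2,x)\,dx+\frac{\log\lambda}{4}\int_{t_1}^{t_2}\dot\kappa\,\lambda^{1-\kappa}\,dt\int_{\mathbb{B}^d}\chi\bigl((|u_\lambda|^2-1)^2\bigr)\,dx=\int_{\mathbb{B}^d}\mathbf{e}_\lambda(t_1,x)\,dx.$$
   Context: $d,D\ge2$ are integers, $\mathbb{B}^d$ is the open unit ball of $\mathbb{R}^d$ centred at $0$, $Q(T)=(0,T)\times\mathbb{B}^d$, $\partial Q(T)=[0,T)\times\partial\mathbb{B}^d\cup\{0\}\times\mathbb{B}^d$. $\kappa=\kappa(t)=\arctan(t)/\pi$; $\chi$ is a smooth function with $\chi(t)=t$ for $t<2$, $\chi(t)=3$ for $t\ge4$, $\chi\le3$; dots denote derivatives. The classical Ginzburg–Landau heat flow (classical GLHF) with smooth, time-independent data $u_0$ is the classical solution $u_\lambda\in C^\infty(\overline{Q(T)};\mathbb{R}^{D+1})$ of $$\frac{\partial u_\lambda}{\partial t}-\triangle u_\lambda+\lambda^{1-\kappa}\dot\chi\bigl((|u_\lambda|^2-1)^2\bigr)(|u_\lambda|^2-1)u_\lambda=0\ \text{in }Q(T),\qquad u_\lambda=u_0\ \text{on }\partial Q(T).$$ The Ginzburg–Landau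 energy density is $\mathbf{e}_\lambda=\tfrac12|\nabla u_\lambda|^2+\tfrac{\lambda^{1-\kappa}}4\chi\bigl((|u_\lambda|^2-1)^2\bigr)$. *)

theory Defs
  imports "HOL-Analysis.Analysis"
begin

text \<open>The class \<open>C^k\<close> of the closure of an open set \<open>S\<close>: the partial derivatives of order up to
  \<open>k\<close> exist in \<open>S\<close> and extend continuously to the closure of \<open>S\<close>.  Each \<open>g\<close> below is such an
  extended partial derivative; continuity determines it on the closure, and values off the closure
  play no role.\<close>

primrec Ck_closure ::
  "nat \<Rightarrow> 'a::euclidean_space set \<Rightarrow> ('a \<Rightarrow> 'b::real_normed_vector) \<Rightarrow> bool" where
  "Ck_closure 0 = (\<lambda>S f. continuous_on (closure S) f)"
| "Ck_closure (Suc k) = (\<lambda>S f. continuous_on (closure S) f \<and>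
     (\<forall>b\<in>Basis. \<exists>g.
        (\<forall>x\<in>S. ((\<lambda>h. f (x + h *\<^sub>R b)) has_vector_derivative g x) (at 0)) \<and>
        Ck_closure k S g))"

definition smooth_closure ::
  "'a::euclidean_space set \<Rightarrow> ('a \<Rightarrow> 'b::real_normed_vector) \<Rightarrow> bool" where
  "smooth_closure S f \<longleftrightarrow> (\<forall>k. Ck_closure k S f)"

definition partial ::
  "'d::finite \<Rightarrow> (real ^ 'd \<Rightarrow> 'b::real_normed_vector) \<Rightarrow> real ^ 'd \<Rightarrow> 'b" where
  "partial i f x = vector_derivative (\<lambda>h. f (x + h *\<^sub>R axis i 1)) (at 0)"

definition laplacian ::
  "(real ^ 'd::finite \<Rightarrow> 'b::real_normed_vector) \<Rightarrow> real ^ 'd \<Rightarrow> 'b" where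
  "laplacian f x = (\<Sum>i\<in>UNIV. partial i (partial i f) x)"

definition grad_norm_sq ::
  "(real ^ 'd::finite \<Rightarrow> 'b::real_normed_vector) \<Rightarrow> real ^ 'd \<Rightarrow> real" where
  "grad_norm_sq f x = (\<Sum>i\<in>UNIV. (norm (partial i f x))\<^sup>2)"

definition time_deriv ::
  "(real \<times> 'a \<Rightarrow> 'b::real_normed_vector) \<Rightarrow> real \<Rightarrow> 'a \<Rightarrow> 'b" where
  "time_deriv u t x = vector_derivative (\<lambda>s. u (s, x)) (at t)"

definition kappa :: "real \<Rightarrow> real" where
  "kappa t = arctan t / pi"

definition gl_cutoff :: "(real \<Rightarrow> real) \<Rightarrow> bool" where
  "gl_cutoff chi \<longleftrightarrow> smooth_closure UNIV chi \<and>
     (\<forall>t<2. chi t = t) \<and> (\<forall>t\<ge>4. chi t = 3) \<and> (\<forall>t. chi t \<le> 3)"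

definition cyl :: "real \<Rightarrow> (real \<times> (real ^ 'd::finite)) set" where
  "cyl T = {0<..<T} \<times> ball 0 1"

text \<open>The parabolic boundary; the top \<open>{T} \<times> ball 0 1\<close> does not belong to it.\<close>

definition cyl_bdry :: "real \<Rightarrow> (real \<times> (real ^ 'd::finite)) set" where
  "cyl_bdry T = {0..<T} \<times> sphere 0 1 \<union> {0} \<times> ball 0 1"

definition classical_GLHF ::
  "(real \<Rightarrow> real) \<Rightarrow> real \<Rightarrow> real \<Rightarrow> (real ^ 'd::finite \<Rightarrow> real ^ 'm::finite)
     \<Rightarrow> (real \<times> (real ^ 'd) \<Rightarrow> real ^ 'm) \<Rightarrow> bool" where
  "classical_GLHF chi T lam u0 u \<longleftrightarrow>
     smooth_closure (ball 0 1) u0 \<and>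
     smooth_closure (cyl T) u \<and>
     (\<forall>(t, x)\<in>cyl T.
        time_deriv u t x - laplacian (\<lambda>y. u (t, y)) x
        + (lam powr (1 - kappa t) * deriv chi (((norm (u (t, x)))\<^sup>2 - 1)\<^sup>2)
             * ((norm (u (t, x)))\<^sup>2 - 1)) *\<^sub>R u (t, x) = 0) \<and>
     (\<forall>(t, x)\<in>cyl_bdry T. u (t, x) = u0 x)"

definition gl_energy ::
  "(real \<Rightarrow> real) \<Rightarrow> real \<Rightarrow> (real \<times> (real ^ 'd::finite) \<Rightarrow> real ^ 'm::finite)
     \<Rightarrow> real \<Rightarrow> real ^ 'd \<Rightarrow> real" where
  "gl_energy chi lam u t x =
     1/2 * grad_norm_sq (\<lambda>y. u (t, y)) x
     + lam powr (1 - kappa t) / 4 * chi (((norm (u (t, x)))\<^sup>2 - 1)\<^sup>2)"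

end

theory Submission
  imports Defs
begin

text \<open>Let \<open>k\<close> be the time derivative of the energy density.  Inserting the equation gives
  \<open>k = (\<Sum>i. \<partial>\<^sub>i (u\<^sub>t \<bullet> \<partial>\<^sub>i u)) - |u\<^sub>t|\<^sup>2 - log \<lambda> / 4 * \<kappa>' \<lambda>\<^sup>1\<^sup>-\<^sup>\<kappa> \<chi>\<close>.
  Since the boundary data do not depend on time, \<open>u\<^sub>t\<close> vanishes on the lateral boundary, so the
  divergence integrates to zero over the ball.  No divergence theorem is needed for this: a function
  vanishing on the frontier extends by zero to a Lipschitz function along each coordinate direction,
  the integrals of its difference quotients vanish by translation invariance, and dominated
  convergence applies.  The identity follows by integrating \<open>k\<close> in time and exchanging the order of
  integration.\<close>

section \<open>Directional derivatives and mean value inequalities\<close>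

text \<open>\<open>Ck_closure\<close> differentiates at parameter \<open>0\<close> from a moving
  base point; mean value arguments along a line need a fixed base point and a moving
  parameter.\<close>

lemma directional_derivative_shift:
  fixes x b :: "'a::real_vector"
  assumes "((\<lambda>h. f (x + t *\<^sub>R b + h *\<^sub>R b)) has_vector_derivative v) (at 0)"
  shows "((\<lambda>h. f (x + h *\<^sub>R b)) has_vector_derivative v) (at t)"
proof -
  have "((\<lambda>h. h - t) has_vector_derivative 1) (at t)"
    by (auto intro!: derivative_eq_intros)
  from vector_diff_chain_at[OF this, of "\<lambda>h. f (x + t *\<^sub>R b + h *\<^sub>R b)" v] assms
  have "((\<lambda>h. f (x + t *\<^sub>R b + (h - t) *\<^sub>R b)) has_vector_derivative v) (at t)"
    by (simp add: o_def)
  moreover have "x + t *\<^sub>R b + (h - t) *\<^sub>R b = x + h *\<^sub>R b" for h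
    by (simp add: algebra_simps)
  ultimately show ?thesis by simp
qed

lemma in_segment_0_real: "t \<in> closed_segment 0 h \<longleftrightarrow> (\<exists>k. 0 \<le> k \<and> k \<le> 1 \<and> t = k * h)"
  for t h :: real
  unfolding in_segment by auto

text \<open>Subtracting \<open>t v\<close> from \<open>f\<close> along the line leaves a function
  with derivative \<open>g - v\<close>, bounded by \<open>e\<close>. The choice \<open>v = 0\<close>
  gives Lipschitz bounds, the choice \<open>v = g x\<close> differentiability.\<close>

lemma directional_mvt:
  fixes f g :: "'a::real_normed_vector \<Rightarrow> 'b::real_normed_vector"
  assumes D: "\<And>t. t \<in> closed_segment 0 h \<Longrightarrow>
      ((\<lambda>s. f (x + t *\<^sub>R b + s *\<^sub>R b)) has_vector_derivative g (x + t *\<^sub>R b)) (at 0)"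
    and B: "\<And>t. t \<in> closed_segment 0 h \<Longrightarrow> norm (g (x + t *\<^sub>R b) - v) \<le> e"
  shows "norm (f (x + h *\<^sub>R b) - f x - h *\<^sub>R v) \<le> e * \<bar>h\<bar>"
proof -
  let ?S = "closed_segment 0 h"
  let ?p = "\<lambda>t. f (x + t *\<^sub>R b) - t *\<^sub>R v"
  have "norm (?p h - ?p 0) \<le> e * norm (h - 0)"
  proof (rule differentiable_bound[where S = ?S
        and f' = "\<lambda>t s. s *\<^sub>R (g (x + t *\<^sub>R b) - v)"])
    fix t assume t: "t \<in> ?S"
    have "(?p has_vector_derivative (g (x + t *\<^sub>R b) - v)) (at t within ?S)"
      by (rule has_vector_derivative_at_within)
         (auto intro!: derivative_eq_intros directional_derivative_shift[OF D[OF t]])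
    then show "(?p has_derivative (\<lambda>s. s *\<^sub>R (g (x + t *\<^sub>R b) - v))) (at t within ?S)"
      by (simp add: has_vector_derivative_def)
    show "onorm (\<lambda>s. s *\<^sub>R (g (x + t *\<^sub>R b) - v)) \<le> e"
      using B[OF t]
      by (intro onorm_le) (simp add: mult.commute[of e] mult_left_mono)
  qed auto
  then show ?thesis by (simp add: algebra_simps)
qed

text \<open>The point \<open>x\<close> and the segment may lie on the frontier, where \<open>f\<close> need not be differentiable:
  shrink towards an interior point \<open>c\<close> and pass to the limit.\<close>

lemma directional_mvt_closure:
  fixes f g :: "'a::euclidean_space \<Rightarrow> 'b::real_normed_vector"
  assumes S: "open S" "convex S" "S \<noteq> {}"
    and f: "continuous_on (closure S) f" and g: "continuous_on (closure S) g"
    and D: "\<And>x. x \<in> S \<Longrightarrow> ((\<lambda>h. f (x + h *\<^sub>R b)) has_vector_derivative g x) (at 0)"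
    and x: "x \<in> closure S" and y: "x + h *\<^sub>R b \<in> closure S"
    and B: "\<And>t. t \<in> closed_segment 0 h \<Longrightarrow> x + t *\<^sub>R b \<in> closure S \<Longrightarrow> norm (g (x + t *\<^sub>R b) - v) \<le> e"
  shows "norm (f (x + h *\<^sub>R b) - f x - h *\<^sub>R v) \<le> e * \<bar>h\<bar>"
proof -
  obtain c where c: "c \<in> S" using S by blast
  \<comment> \<open>\<open>p r\<close> is the contraction towards \<open>c\<close> with factor
    \<open>1 - r\<close>; by convexity it moves the closure into \<open>S\<close> for
    \<open>0 < r \<le> 1\<close>.\<close>
  define p where "p = (\<lambda>r w. w - r *\<^sub>R (w - c))"
  have pS: "p r w \<in> S" if "w \<in> closure S" "0 < r" "r \<le> 1" for r w
    using mem_interior_closure_convex_shrink[of S c w r] that S c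
    by (auto simp: p_def interior_open)
  have seg: "x + t *\<^sub>R b \<in> closure S" if t: "t \<in> closed_segment 0 h" for t
  proof -
    obtain k where k: "0 \<le> k" "k \<le> 1" "t = k * h" using t unfolding in_segment_0_real by blast
    have "x + t *\<^sub>R b = (1 - k) *\<^sub>R x + k *\<^sub>R (x + h *\<^sub>R b)"
      by (simp add: k(3) algebra_simps)
    also have "\<dots> \<in> closure S"
      using convexD[OF convex_closure[OF S(2)] x y, of "1 - k" k] k by simp
    finally show ?thesis .
  qed
  have pt: "p r (x + t *\<^sub>R b) = p r x + ((1 - r) * t) *\<^sub>R b" for r t
    by (simp add: p_def algebra_simps)
  have comp: "compact ((\<lambda>t. x + t *\<^sub>R b) ` closed_segment 0 h)" (is "compact ?C")
    by (intro compact_continuous_image continuous_intros) auto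
  \<comment> \<open>The contracted segment lies in \<open>S\<close> and keeps the direction
    \<open>b\<close>, so the interior estimate applies to it; \<open>d\<close> measures the change
    of \<open>g\<close> under the contraction.\<close>
  have *: "norm (f (p r (x + h *\<^sub>R b)) - f (p r x) - ((1 - r) * h) *\<^sub>R v) \<le> (e + d) * \<bar>(1 - r) * h\<bar>"
    if r: "0 < r" "r < 1" and d: "\<And>w. w \<in> ?C \<Longrightarrow> norm (g (p r w) - g w) \<le> d" for r d
    unfolding pt
  proof (rule directional_mvt)
    fix s assume "s \<in> closed_segment 0 ((1 - r) * h)"
    then obtain k where k: "0 \<le> k" "k \<le> 1" "s = k * ((1 - r) * h)" unfolding in_segment_0_real by blast
    define t where "t = k * h"
    have t: "t \<in> closed_segment 0 h" using k unfolding in_segment_0_real t_def by blast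
    have st: "p r x + s *\<^sub>R b = p r (x + t *\<^sub>R b)"
      unfolding pt by (simp add: k(3) t_def mult.left_commute)
    have "p r x + s *\<^sub>R b \<in> S" unfolding st using pS[OF seg[OF t]] r by auto
    then show "((\<lambda>q. f (p r x + s *\<^sub>R b + q *\<^sub>R b)) has_vector_derivative g (p r x + s *\<^sub>R b)) (at 0)"
      by (rule D)
    have "norm (g (p r (x + t *\<^sub>R b)) - v)
        \<le> norm (g (x + t *\<^sub>R b) - v) + norm (g (p r (x + t *\<^sub>R b)) - g (x + t *\<^sub>R b))"
      by (metis add.commute diff_add_cancel add_diff_eq norm_triangle_ineq)
    also have "\<dots> \<le> e + d" using B[OF t seg[OF t]] d t by (intro add_mono) auto
    finally show "norm (g (p r x + s *\<^sub>R b) - v) \<le> e + d" unfolding st .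
  qed
  have lim_p: "((\<lambda>r. p r w) \<longlongrightarrow> w) (at_right 0)" for w
    unfolding p_def by (auto intro!: tendsto_eq_intros)
  have ev01: "eventually (\<lambda>r. 0 < r \<and> r < (1::real)) (at_right 0)"
    by (intro eventually_at_rightI[of 0 1]) auto
  have lim_f: "((\<lambda>r. f (p r w)) \<longlongrightarrow> f w) (at_right 0)" if "w \<in> closure S" for w
  proof (rule continuous_on_tendsto_compose[OF f lim_p that])
    show "\<forall>\<^sub>F r in at_right 0. p r w \<in> closure S"
      using ev01 by eventually_elim (use pS[OF that] closure_subset[of S] in auto)
  qed
  have fin: "norm (f (x + h *\<^sub>R b) - f x - h *\<^sub>R v) \<le> (e + d) * \<bar>h\<bar>" if d: "d > 0" for d
  proof -
    \<comment> \<open>\<open>K\<close> is swept out by the segment under all contractions, with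
      \<open>r = 0\<close> included so that it also contains the segment itself. Uniform continuity
      of \<open>g\<close> on this compact set makes any \<open>d > 0\<close> admissible once
      \<open>r\<close> is small.\<close>
    define K where "K = (\<lambda>(r, w). p r w) ` ({0..1} \<times> ?C)"
    have K: "compact K" unfolding K_def p_def
      using comp by (intro compact_continuous_image)
         (auto intro!: continuous_intros compact_Times simp: case_prod_unfold)
    have KS: "K \<subseteq> closure S"
    proof
      fix z assume "z \<in> K"
      then obtain r t where z: "z = p r (x + t *\<^sub>R b)" "0 \<le> r" "r \<le> 1" "t \<in> closed_segment 0 h"
        by (auto simp: K_def)
      show "z \<in> closure S"
      proof (cases "r = 0")
        case True then show ?thesis using seg[OF z(4)] z(1) by (simp add: p_def)
      next
        case False then show ?thesis
          using pS[OF seg[OF z(4)], of r] z closure_subset[of S] by auto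
      qed
    qed
    have pK: "p r w \<in> K" if "w \<in> ?C" "0 \<le> r" "r \<le> 1" for r w
      unfolding K_def using that by (intro image_eqI[where x = "(r, w)"]) auto
    have CK: "w \<in> K" if "w \<in> ?C" for w
      using pK[OF that, of 0] by (simp add: p_def)
    have "uniformly_continuous_on K g"
      using compact_uniformly_continuous[OF continuous_on_subset[OF g KS] K] .
    then obtain \<delta> where \<delta>: "\<delta> > 0"
      "\<And>w w'. w \<in> K \<Longrightarrow> w' \<in> K \<Longrightarrow> dist w' w < \<delta> \<Longrightarrow> dist (g w') (g w) < d"
      using d unfolding uniformly_continuous_on_def by metis
    obtain M where M: "\<And>w. w \<in> ?C \<Longrightarrow> norm (w - c) \<le> M" "M > 0"
    proof -
      have "bounded ((\<lambda>w. w - c) ` ?C)"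
        by (intro compact_imp_bounded compact_continuous_image[OF _ comp] continuous_intros)
      then show ?thesis using that unfolding bounded_pos by blast
    qed
    \<comment> \<open>\<open>p r\<close> moves points of the segment by at most
      \<open>r * M\<close>, hence the threshold \<open>\<delta> / M\<close>.\<close>
    have "eventually (\<lambda>r. r < \<delta> / M) (at_right (0::real))"
      using \<delta> M by (intro eventually_at_rightI[of 0 "\<delta> / M"]) auto
    with ev01 have "eventually (\<lambda>r. norm (f (p r (x + h *\<^sub>R b)) - f (p r x) - ((1 - r) * h) *\<^sub>R v)
         \<le> (e + d) * \<bar>(1 - r) * h\<bar>) (at_right 0)"
    proof eventually_elim
      case (elim r)
      show ?case
      proof (rule *)
        fix w assume w: "w \<in> ?C"
        have "p r w \<in> K" using pK[OF w] elim by simp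
        moreover have "dist (p r w) w < \<delta>"
        proof -
          have "dist (p r w) w = r * norm (w - c)" using elim by (simp add: p_def dist_norm)
          also have "\<dots> \<le> r * M" using M(1)[OF w] elim by (intro mult_left_mono) auto
          also have "\<dots> < \<delta>" using elim M by (simp add: field_simps)
          finally show ?thesis .
        qed
        ultimately have "dist (g (p r w)) (g w) < d" using \<delta>(2)[OF CK[OF w]] by blast
        then show "norm (g (p r w) - g w) \<le> d" by (simp add: dist_norm)
      qed (use elim in auto)
    qed
    moreover have "((\<lambda>r. norm (f (p r (x + h *\<^sub>R b)) - f (p r x) - ((1 - r) * h) *\<^sub>R v))
        \<longlongrightarrow> norm (f (x + h *\<^sub>R b) - f x - ((1 - 0) * h) *\<^sub>R v)) (at_right 0)"
      by (intro tendsto_intros lim_f x y)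
    moreover have "((\<lambda>r. (e + d) * \<bar>(1 - r) * h\<bar>) \<longlongrightarrow> (e + d) * \<bar>(1 - 0) * h\<bar>) (at_right 0)"
      by (intro tendsto_intros)
    ultimately show ?thesis
      using tendsto_le[OF trivial_limit_at_right_real] by fastforce
  qed
  have "((\<lambda>d. (e + d) * \<bar>h\<bar>) \<longlongrightarrow> (e + 0) * \<bar>h\<bar>) (at_right 0)"
    by (intro tendsto_intros)
  then have "norm (f (x + h *\<^sub>R b) - f x - h *\<^sub>R v) \<le> (e + 0) * \<bar>h\<bar>"
    by (rule tendsto_lowerbound) (auto intro!: eventually_at_rightI[of 0 1] fin)
  then show ?thesis by simp
qed

text \<open>Near \<open>x\<close>, continuity keeps \<open>g\<close> within \<open>e\<close> of
  \<open>g x\<close>, so the mean value inequality with \<open>v = g x\<close> bounds the error by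
  \<open>e * \<bar>h\<bar>\<close>. Restricting \<open>h\<close> to the parameters that stay in the
  closure covers frontier points, where the derivative may be one-sided.\<close>

lemma directional_derivative_closure:
  fixes f g :: "'a::euclidean_space \<Rightarrow> 'b::real_normed_vector"
  assumes S: "open S" "convex S" "S \<noteq> {}"
    and f: "continuous_on (closure S) f" and g: "continuous_on (closure S) g"
    and D: "\<And>x. x \<in> S \<Longrightarrow> ((\<lambda>h. f (x + h *\<^sub>R b)) has_vector_derivative g x) (at 0)"
    and x: "x \<in> closure S"
  shows "((\<lambda>h. f (x + h *\<^sub>R b)) has_vector_derivative g x) (at 0 within {h. x + h *\<^sub>R b \<in> closure S})"
  unfolding has_vector_derivative_def has_derivative_within_alt
proof (intro conjI allI impI)
  show "bounded_linear (\<lambda>h. h *\<^sub>R g x)" by (rule bounded_linear_scaleR_left)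
next
  fix e :: real assume e: "e > 0"
  obtain d where d: "d > 0" "\<And>y. y \<in> closure S \<Longrightarrow> dist y x < d \<Longrightarrow> dist (g y) (g x) < e"
    using g x e unfolding continuous_on_iff by metis
  show "\<exists>d>0. \<forall>h\<in>{h. x + h *\<^sub>R b \<in> closure S}. norm (h - 0) < d \<longrightarrow>
      norm (f (x + h *\<^sub>R b) - f (x + 0 *\<^sub>R b) - (h - 0) *\<^sub>R g x) \<le> e * norm (h - 0)"
  proof (intro exI[of _ "d / (norm b + 1)"] conjI ballI impI)
    show "d / (norm b + 1) > 0" using d(1) by (simp add: add_nonneg_pos)
    fix h assume h: "h \<in> {h. x + h *\<^sub>R b \<in> closure S}" "norm (h - 0) < d / (norm b + 1)"
    have "norm (f (x + h *\<^sub>R b) - f x - h *\<^sub>R g x) \<le> e * \<bar>h\<bar>"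
    proof (rule directional_mvt_closure[OF S f g D x])
      show hc: "x + h *\<^sub>R b \<in> closure S" using h by simp
      fix t assume "t \<in> closed_segment 0 h"
      then obtain k where k: "0 \<le> k" "k \<le> 1" "t = k * h" unfolding in_segment_0_real by blast
      assume "x + t *\<^sub>R b \<in> closure S"
      moreover have "dist (x + t *\<^sub>R b) x < d"
      proof -
        have "dist (x + t *\<^sub>R b) x = k * (\<bar>h\<bar> * norm b)" using k by (simp add: dist_norm abs_mult)
        also have "\<dots> \<le> 1 * (\<bar>h\<bar> * norm b)" using k by (intro mult_right_mono) auto
        also have "\<dots> \<le> \<bar>h\<bar> * (norm b + 1)" by (simp add: algebra_simps)
        also have "\<dots> < d" using h(2) norm_ge_zero[of b] by (simp add: pos_less_divide_eq add_nonneg_pos)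
        finally show ?thesis .
      qed
      ultimately have "dist (g (x + t *\<^sub>R b)) (g x) < e" by (rule d(2))
      then show "norm (g (x + t *\<^sub>R b) - g x) \<le> e" by (simp add: dist_norm)
    qed
    then show "norm (f (x + h *\<^sub>R b) - f (x + 0 *\<^sub>R b) - (h - 0) *\<^sub>R g x) \<le> e * norm (h - 0)"
      by simp
  qed
qed

section \<open>Symmetry of mixed second derivatives\<close>

text \<open>Two nested mean value inequalities: in direction \<open>b\<close> for the increment of
  \<open>fa\<close>, then in direction \<open>a\<close> for the increment
  \<open>f (y + h b) - f y\<close>, whose derivative is that increment of \<open>fa\<close>.\<close>

lemma second_difference_bound:
  fixes f :: "'a::real_normed_vector \<Rightarrow> 'b::real_normed_vector"
  assumes fa: "\<And>x. x \<in> S \<Longrightarrow> ((\<lambda>h. f (x + h *\<^sub>R a)) has_vector_derivative fa x) (at 0)"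
    and fab: "\<And>x. x \<in> S \<Longrightarrow> ((\<lambda>h. fa (x + h *\<^sub>R b)) has_vector_derivative fab x) (at 0)"
    and h: "h \<ge> 0"
    and S: "\<And>s t. s \<in> {0..h} \<Longrightarrow> t \<in> {0..h} \<Longrightarrow> x + s *\<^sub>R a + t *\<^sub>R b \<in> S"
    and B: "\<And>y. y \<in> S \<Longrightarrow> norm (fab y - v) \<le> e"
  shows "norm (f (x + h *\<^sub>R a + h *\<^sub>R b) - f (x + h *\<^sub>R b) - (f (x + h *\<^sub>R a) - f x) - (h * h) *\<^sub>R v)
    \<le> e * (h * h)"
proof -
  let ?p = "\<lambda>y. f (y + h *\<^sub>R b) - f y"
  have seg: "closed_segment 0 h = {0..h}" using h by (simp add: closed_segment_eq_real_ivl)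
  have "norm (?p (x + h *\<^sub>R a) - ?p x - h *\<^sub>R (h *\<^sub>R v)) \<le> (e * \<bar>h\<bar>) * \<bar>h\<bar>"
  proof (rule directional_mvt[where g = "\<lambda>y. fa (y + h *\<^sub>R b) - fa y"])
    fix s assume s: "s \<in> closed_segment 0 h"
    have "((\<lambda>r. f (x + s *\<^sub>R a + h *\<^sub>R b + r *\<^sub>R a)) has_vector_derivative fa (x + s *\<^sub>R a + h *\<^sub>R b)) (at 0)"
      "((\<lambda>r. f (x + s *\<^sub>R a + r *\<^sub>R a)) has_vector_derivative fa (x + s *\<^sub>R a)) (at 0)"
      using fa[OF S[of s h]] fa[OF S[of s 0]] s h seg by auto
    from has_vector_derivative_diff[OF this]
    show "((\<lambda>r. ?p (x + s *\<^sub>R a + r *\<^sub>R a)) has_vector_derivative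
        fa (x + s *\<^sub>R a + h *\<^sub>R b) - fa (x + s *\<^sub>R a)) (at 0)"
      by (simp add: add.commute add.left_commute)
    show "norm (fa (x + s *\<^sub>R a + h *\<^sub>R b) - fa (x + s *\<^sub>R a) - h *\<^sub>R v) \<le> e * \<bar>h\<bar>"
      by (rule directional_mvt[where g = fab])
         (use S s seg in \<open>auto intro!: fab B\<close>)
  qed
  then show ?thesis using h by (simp add: mult.assoc algebra_simps)
qed

text \<open>Schwarz's argument: one and the same second difference, divided by \<open>h * h\<close>,
  lies within \<open>e\<close> of both mixed derivatives, for every \<open>e > 0\<close>.\<close>

lemma mixed_directional_derivatives_eq:
  fixes f :: "'a::real_normed_vector \<Rightarrow> 'b::real_normed_vector"
  assumes S: "open S"
    and fa: "\<And>x. x \<in> S \<Longrightarrow> ((\<lambda>h. f (x + h *\<^sub>R a)) has_vector_derivative fa x) (at 0)"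
    and fb: "\<And>x. x \<in> S \<Longrightarrow> ((\<lambda>h. f (x + h *\<^sub>R b)) has_vector_derivative fb x) (at 0)"
    and fab: "\<And>x. x \<in> S \<Longrightarrow> ((\<lambda>h. fa (x + h *\<^sub>R b)) has_vector_derivative fab x) (at 0)"
    and fba: "\<And>x. x \<in> S \<Longrightarrow> ((\<lambda>h. fb (x + h *\<^sub>R a)) has_vector_derivative fba x) (at 0)"
    and cont: "continuous_on S fab" "continuous_on S fba"
    and x: "x \<in> S"
  shows "fab x = fba x"
proof -
  have *: "norm (fab x - fba x) \<le> 2 * e" if e: "e > 0" for e
  proof -
    obtain r1 where r1: "r1 > 0" "ball x r1 \<subseteq> S" using S x openE by blast
    obtain r2 where r2: "r2 > 0" "\<And>y. y \<in> S \<Longrightarrow> dist y x < r2 \<Longrightarrow> dist (fab y) (fab x) < e"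
      using cont(1) x e unfolding continuous_on_iff by metis
    obtain r3 where r3: "r3 > 0" "\<And>y. y \<in> S \<Longrightarrow> dist y x < r3 \<Longrightarrow> dist (fba y) (fba x) < e"
      using cont(2) x e unfolding continuous_on_iff by metis
    define r where "r = min r1 (min r2 r3)"
    have r: "r > 0" using r1 r2 r3 by (simp add: r_def)
    \<comment> \<open>This size keeps the parallelogram spanned at \<open>x\<close> by
      \<open>h a\<close> and \<open>h b\<close> inside the ball of radius \<open>r\<close>; the
      summand \<open>1\<close> covers the case \<open>a = b = 0\<close>.\<close>
    define h where "h = r / (norm a + norm b + 1)"
    have pos: "norm a + norm b + 1 > 0" by (simp add: add_nonneg_pos)
    have h: "h > 0" using r pos by (simp add: h_def)
    have in_ball: "x + s *\<^sub>R a + t *\<^sub>R b \<in> ball x r" if "s \<in> {0..h}" "t \<in> {0..h}" for s t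
    proof -
      have "dist x (x + s *\<^sub>R a + t *\<^sub>R b) = norm (s *\<^sub>R a + t *\<^sub>R b)"
        by (metis add.assoc dist_0_norm dist_add_cancel add.right_neutral)
      also have "\<dots> \<le> s * norm a + t * norm b"
        using that by (intro order.trans[OF norm_triangle_ineq]) simp
      also have "\<dots> \<le> h * norm a + h * norm b"
        using that by (intro add_mono mult_right_mono) auto
      also have "\<dots> < h * (norm a + norm b + 1)" using h by (simp add: algebra_simps)
      also have "\<dots> = r" using pos by (simp add: h_def)
      finally show ?thesis by simp
    qed
    have sub: "y \<in> S" if "y \<in> ball x r" for y using that r1 by (auto simp: r_def)
    let ?d = "f (x + h *\<^sub>R a + h *\<^sub>R b) - f (x + h *\<^sub>R b) - (f (x + h *\<^sub>R a) - f x)"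
    have 1: "norm (?d - (h * h) *\<^sub>R fab x) \<le> e * (h * h)"
    proof (rule second_difference_bound[where S = "ball x r" and fa = fa])
      show "norm (fab y - fab x) \<le> e" if "y \<in> ball x r" for y
        using r2(2)[OF sub[OF that]] that by (simp add: r_def dist_norm norm_minus_commute less_imp_le)
    qed (use h in \<open>auto intro: fa fab sub in_ball simp del: mem_ball atLeastAtMost_iff\<close>)
    have "norm (f (x + h *\<^sub>R b + h *\<^sub>R a) - f (x + h *\<^sub>R a) - (f (x + h *\<^sub>R b) - f x) - (h * h) *\<^sub>R fba x) \<le> e * (h * h)"
    proof (rule second_difference_bound[where S = "ball x r" and fa = fb])
      show "norm (fba y - fba x) \<le> e" if "y \<in> ball x r" for y
        using r3(2)[OF sub[OF that]] that by (simp add: r_def dist_norm norm_minus_commute less_imp_le)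
      show "x + s *\<^sub>R b + t *\<^sub>R a \<in> ball x r" if "s \<in> {0..h}" "t \<in> {0..h}" for s t
        using in_ball[OF that(2,1)] by (simp add: add.commute add.left_commute)
    qed (use h in \<open>auto intro: fb fba sub simp del: mem_ball\<close>)
    \<comment> \<open>Interchanging \<open>a\<close> and \<open>b\<close> only regroups the second
      difference, so both estimates concern the same \<open>?d\<close>.\<close>
    then have 2: "norm (?d - (h * h) *\<^sub>R fba x) \<le> e * (h * h)"
      by (simp add: algebra_simps)
    have "norm ((h * h) *\<^sub>R (fab x - fba x)) = norm ((?d - (h * h) *\<^sub>R fba x) - (?d - (h * h) *\<^sub>R fab x))"
      by (simp add: algebra_simps)
    also have "\<dots> \<le> e * (h * h) + e * (h * h)"
      using norm_triangle_ineq4[of "?d - (h * h) *\<^sub>R fba x" "?d - (h * h) *\<^sub>R fab x"] 1 2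
      by linarith
    finally have "\<bar>h * h\<bar> * norm (fab x - fba x) \<le> e * (h * h) + e * (h * h)"
      unfolding norm_scaleR .
    then have "(h * h) * norm (fab x - fba x) \<le> (h * h) * (2 * e)"
      by (simp add: algebra_simps)
    then show ?thesis using h by simp
  qed
  have "norm (fab x - fba x) \<le> 0"
  proof (rule field_le_epsilon)
    fix e :: real assume "e > 0"
    then show "norm (fab x - fba x) \<le> 0 + e" using *[of "e / 2"] by simp
  qed
  then show ?thesis by simp
qed

section \<open>Integration over bounded open sets\<close>

lemma lborel_translation:
  fixes f :: "'a::euclidean_space \<Rightarrow> real"
  assumes "integrable lborel f"
  shows "integrable lborel (\<lambda>x. f (x + c))" "(LINT x|lborel. f (x + c)) = (LINT x|lborel. f x)"
proof -
  have "integrable (distr lborel borel ((+) c)) f"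
    using assms by (simp add: lborel_distr_plus)
  then have "integrable lborel (\<lambda>x. f (c + x))"
    by (rule integrable_distr[rotated]) simp
  then show "integrable lborel (\<lambda>x. f (x + c))" by (simp add: add.commute)
  have "(LINT x|distr lborel borel ((+) c). f x) = (LINT x|lborel. f (c + x))"
    using assms by (intro integral_distr) auto
  then show "(LINT x|lborel. f (x + c)) = (LINT x|lborel. f x)"
    by (simp add: lborel_distr_plus add.commute)
qed

lemma AE_notin_frontier_convex:
  fixes S :: "'a::euclidean_space set"
  assumes "convex S"
  shows "AE x in lborel. x \<notin> frontier S"
proof -
  have "frontier S \<in> null_sets lborel"
    using negligible_convex_frontier[OF assms]
    by (simp add: negligible_iff_null_sets null_sets_completion_iff)
  then show ?thesis by (rule AE_not_in)
qed

lemma set_integrable_continuous_closure: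
  fixes f :: "'a::euclidean_space \<Rightarrow> 'b::euclidean_space"
  assumes "bounded S" "continuous_on (closure S) f" "S \<in> sets borel"
  shows "set_integrable lborel S f"
proof (rule set_integrable_subset)
  show "set_integrable lborel (closure S) f"
    unfolding set_integrable_def using assms by (intro borel_integrable_compact) auto
qed (use assms closure_subset in auto)

text \<open>This is the divergence theorem for a field of constant direction \<open>b\<close> that
  vanishes on the frontier. The mean value bound on the closure supplies the Lipschitz constant
  \<open>M\<close>, and convexity makes the frontier a null set.\<close>

lemma integral_directional_derivative_eq_0:
  fixes f g :: "'a::euclidean_space \<Rightarrow> real"
  assumes S: "open S" "convex S" "bounded S"
    and f: "continuous_on (closure S) f" and g: "continuous_on (closure S) g"
    and D: "\<And>x. x \<in> S \<Longrightarrow> ((\<lambda>h. f (x + h *\<^sub>R b)) has_vector_derivative g x) (at 0)"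
    and zero: "\<And>x. x \<in> frontier S \<Longrightarrow> f x = 0"
  shows "(LINT x:S|lborel. g x) = 0"
proof (cases "S = {}")
  case False
  \<comment> \<open>The indicator of the closure instead of \<open>S\<close> gives the same
    function, as \<open>f\<close> vanishes on the frontier, and makes integrability immediate from
    compactness.\<close>
  define F where "F = (\<lambda>x. indicator (closure S) x * f x)"
  have F_in: "F x = f x" if "x \<in> closure S" for x using that by (simp add: F_def)
  have F_S: "F x = f x" if "x \<in> S" for x using that closure_subset[of S] by (auto simp: F_def)
  have F_out: "F x = 0" if "x \<notin> S" for x
    using that zero[of x] S(1) by (auto simp: F_def indicator_def frontier_def interior_open)
  have comp: "compact (closure S)" using S by simp
  obtain M where M: "M > 0" "\<And>x. x \<in> closure S \<Longrightarrow> norm (g x) \<le> M"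
    using compact_imp_bounded[OF compact_continuous_image[OF g comp]] unfolding bounded_pos by auto
  obtain R where R: "\<And>x. x \<in> S \<Longrightarrow> norm x \<le> R"
    using S(3) unfolding bounded_iff by blast
  have lip1: "\<bar>f (x + h *\<^sub>R b) - f x\<bar> \<le> M * \<bar>h\<bar>"
    if "x \<in> closure S" "x + h *\<^sub>R b \<in> closure S" for x h
    using directional_mvt_closure[OF S(1,2) False f g D that, of 0 M] M(2) by simp
  \<comment> \<open>A segment leaving \<open>S\<close> meets the frontier at some \<open>p\<close>,
    where \<open>f\<close> vanishes; the bound between \<open>x\<close> and \<open>p\<close> then
    controls \<open>F x\<close> itself.\<close>
  have lip2: "\<bar>F x\<bar> \<le> M * \<bar>h\<bar>" if out: "x + h *\<^sub>R b \<notin> S" for x h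
  proof (cases "x \<in> S")
    case x: True
    obtain p where p: "p \<in> closed_segment x (x + h *\<^sub>R b)" "p \<in> frontier S"
      using connected_Int_frontier[of "closed_segment x (x + h *\<^sub>R b)" S] x out by auto
    then obtain k where k: "0 \<le> k" "k \<le> 1" "p = (1 - k) *\<^sub>R x + k *\<^sub>R (x + h *\<^sub>R b)"
      by (auto simp: in_segment)
    have pk: "p = x + (k * h) *\<^sub>R b" by (simp add: k(3) algebra_simps)
    have "\<bar>f p - f x\<bar> \<le> M * \<bar>k * h\<bar>"
      unfolding pk using x closure_subset[of S] p(2)
      by (intro lip1) (auto simp: pk[symmetric] frontier_def)
    also have "\<dots> \<le> M * (1 * \<bar>h\<bar>)"
      unfolding abs_mult using k M by (intro mult_left_mono mult_right_mono) auto
    finally show ?thesis using F_in[of x] x closure_subset[of S] zero[OF p(2)] by auto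
  qed (use F_out M in auto)
  have lip: "\<bar>F (x + h *\<^sub>R b) - F x\<bar> \<le> M * \<bar>h\<bar>" for x h
  proof (cases "x \<in> S \<and> x + h *\<^sub>R b \<in> S")
    case True
    then have "x \<in> closure S" "x + h *\<^sub>R b \<in> closure S" using closure_subset[of S] by auto
    then show ?thesis by (simp only: F_in lip1)
  next
    \<comment> \<open>If \<open>x + h b\<close> lies outside \<open>S\<close>, its value is
      \<open>0\<close> and \<open>lip2\<close> bounds \<open>F x\<close>; if \<open>x\<close> does,
      the roles are exchanged with step \<open>- h\<close>.\<close>
    case False
    then show ?thesis
      using lip2[of x h] lip2[of "x + h *\<^sub>R b" "- h"] F_out[of x] F_out[of "x + h *\<^sub>R b"] by fastforce
  qed
  have intF: "integrable lborel F"
    using borel_integrable_compact[OF comp f] by (simp add: F_def)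
  define q where "q = (\<lambda>n x. (F (x + inverse (real (Suc n)) *\<^sub>R b) - F x) / inverse (real (Suc n)))"
  have q0: "(LINT x|lborel. q n x) = 0" for n
    using lborel_translation[OF intF, of "inverse (real (Suc n)) *\<^sub>R b"] intF by (simp add: q_def)
  have "(\<lambda>n. LINT x|lborel. q n x) \<longlonglongrightarrow> (LINT x|lborel. indicator S x * g x)"
  \<comment> \<open>The steps are at most \<open>1\<close>, so every quotient vanishes outside the
    ball of radius \<open>R + norm b\<close>; inside, the Lipschitz constant \<open>M\<close>
    dominates.\<close>
  proof (rule integral_dominated_convergence[where w = "\<lambda>x. indicator (cball 0 (R + norm b)) x *\<^sub>R M"])
    show "(\<lambda>x. indicator S x * g x) \<in> borel_measurable lborel"
      using set_integrable_continuous_closure[OF S(3) g] S(1)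
      by (auto simp: set_integrable_def dest: borel_measurable_integrable)
    show "q n \<in> borel_measurable lborel" for n
      using borel_measurable_integrable[OF lborel_translation(1)[OF intF]]
        borel_measurable_integrable[OF intF] unfolding q_def by measurable
    show "integrable lborel (\<lambda>x. indicator (cball 0 (R + norm b)) x *\<^sub>R M)"
      by (intro borel_integrable_compact) auto
    \<comment> \<open>The exceptional set is the frontier. On \<open>S\<close> the quotients
      eventually agree with those of \<open>f\<close>, and off the closure they are eventually
      \<open>0\<close>, since both sets are open.\<close>
    show "AE x in lborel. (\<lambda>n. q n x) \<longlonglongrightarrow> indicator S x * g x"
      using AE_notin_frontier_convex[OF S(2)]
    proof eventually_elim
      case (elim x)
      have lim0: "(\<lambda>n. inverse (real (Suc n))) \<longlonglongrightarrow> 0" by (rule LIMSEQ_inverse_real_of_nat)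
      have limx: "(\<lambda>n. x + inverse (real (Suc n)) *\<^sub>R b) \<longlonglongrightarrow> x"
        using tendsto_add[OF tendsto_const tendsto_scaleR[OF lim0 tendsto_const], of x b] by simp
      show ?case
      proof (cases "x \<in> S")
        case True
        have "((\<lambda>h. (f (x + h *\<^sub>R b) - f x) / h) \<longlongrightarrow> g x) (at 0)"
          using D[OF True] by (simp add: has_real_derivative_iff_has_vector_derivative[symmetric] DERIV_def)
        moreover have "filterlim (\<lambda>n. inverse (real (Suc n))) (at 0) sequentially"
          using lim0 by (simp add: filterlim_at)
        ultimately have "(\<lambda>n. (f (x + inverse (real (Suc n)) *\<^sub>R b) - f x) / inverse (real (Suc n))) \<longlonglongrightarrow> g x"
          by (rule filterlim_compose)
        moreover have "\<forall>\<^sub>F n in sequentially. x + inverse (real (Suc n)) *\<^sub>R b \<in> S"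
          using limx S(1) True by (rule topological_tendstoD)
        then have "\<forall>\<^sub>F n in sequentially.
            (f (x + inverse (real (Suc n)) *\<^sub>R b) - f x) / inverse (real (Suc n)) = q n x"
          by eventually_elim (simp only: q_def F_S True)
        ultimately have "(\<lambda>n. q n x) \<longlonglongrightarrow> g x" by (rule Lim_transform_eventually)
        then show ?thesis using True by simp
      next
        case False
        then have x: "x \<in> - closure S" using elim S(1) by (auto simp: frontier_def interior_open)
        have "\<forall>\<^sub>F n in sequentially. x + inverse (real (Suc n)) *\<^sub>R b \<in> - closure S"
          using limx _ x by (rule topological_tendstoD) auto
        then have "\<forall>\<^sub>F n in sequentially. 0 = q n x"
          by eventually_elim (use x in \<open>auto simp: q_def F_def\<close>)
        then have "(\<lambda>n. q n x) \<longlonglongrightarrow> 0" by (rule Lim_transform_eventually[OF tendsto_const])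
        then show ?thesis using False by simp
      qed
    qed
    show "AE x in lborel. norm (q n x) \<le> indicator (cball 0 (R + norm b)) x *\<^sub>R M" for n
    proof (rule AE_I2)
      fix x :: 'a
      let ?h = "inverse (real (Suc n))"
      have h: "?h > 0" "?h \<le> 1" by (auto simp: field_simps)
      show "norm (q n x) \<le> indicator (cball 0 (R + norm b)) x *\<^sub>R M"
      proof (cases "x \<in> cball 0 (R + norm b)")
        case True
        have "\<bar>q n x\<bar> \<le> M"
          using lip[of x ?h] h unfolding q_def abs_divide by (subst pos_divide_le_eq) auto
        then show ?thesis using True by simp
      next
        case False
        then have nx: "norm x > R + norm b" by simp
        have "norm x \<le> norm (x + ?h *\<^sub>R b) + norm (?h *\<^sub>R b)"
          by (metis add_diff_cancel_right' norm_triangle_ineq4)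
        also have "norm (?h *\<^sub>R b) \<le> 1 * norm b"
          unfolding norm_scaleR using h by (intro mult_right_mono) auto
        finally have "norm (x + ?h *\<^sub>R b) > R" using nx by simp
        moreover have "norm x > R" using nx norm_ge_zero[of b] by linarith
        ultimately have "x \<notin> S" "x + ?h *\<^sub>R b \<notin> S" using R by (auto simp: not_le[symmetric])
        then show ?thesis using False F_out by (simp add: q_def)
      qed
    qed
  qed
  then show ?thesis
    unfolding q0 using LIMSEQ_unique[OF tendsto_const] by (force simp: set_lebesgue_integral_def)
qed (simp add: set_lebesgue_integral_def)

text \<open>Continuity up to the closure gives integrability over a compact product, hence over
  \<open>{a..b} \<times> U\<close>. The second claim is what later allows time integrals to be
  split.\<close>

lemma Fubini_cylinder:
  fixes f :: "real \<times> 'a::euclidean_space \<Rightarrow> real"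
  assumes U: "open U" "bounded U" and f: "continuous_on ({a..b} \<times> closure U) f"
  shows "(LINT x:U|lborel. LINT t:{a..b}|lborel. f (t, x)) = (LINT t:{a..b}|lborel. LINT x:U|lborel. f (t, x))"
    and "set_integrable lborel {a..b} (\<lambda>t. LINT x:U|lborel. f (t, x))"
proof -
  let ?F = "\<lambda>t x. indicator {a..b} t * (indicator U x * f (t, x))"
  have "set_integrable lborel ({a..b} \<times> closure U) f"
    unfolding set_integrable_def using U f by (intro borel_integrable_compact compact_Times) auto
  then have "set_integrable lborel ({a..b} \<times> U) f"
    by (rule set_integrable_subset)
       (use U closure_subset[of U] in \<open>auto intro!: borel_Times\<close>)
  then have I: "integrable (lborel \<Otimes>\<^sub>M lborel) (\<lambda>(t, x). ?F t x)"
    by (simp add: set_integrable_def lborel_prod indicator_times case_prod_unfold mult.assoc)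
  have 1: "(LINT x|lborel. ?F t x) = indicator {a..b} t * (LINT x:U|lborel. f (t, x))" for t
    by (simp add: set_lebesgue_integral_def)
  have 2: "(LINT t|lborel. ?F t x) = indicator U x * (LINT t:{a..b}|lborel. f (t, x))" for x
    by (simp add: set_lebesgue_integral_def mult.left_commute[of _ "indicator U x"])
  show "(LINT x:U|lborel. LINT t:{a..b}|lborel. f (t, x)) = (LINT t:{a..b}|lborel. LINT x:U|lborel. f (t, x))"
    using lborel_pair.Fubini_integral[OF I] unfolding 1 2 by (simp add: set_lebesgue_integral_def)
  show "set_integrable lborel {a..b} (\<lambda>t. LINT x:U|lborel. f (t, x))"
    using lborel_pair.integrable_fst[OF I] unfolding 1 by (simp add: set_integrable_def)
qed

text \<open>The endpoints form a null set. This matters because the equation and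
  \<open>time_deriv\<close> are only controlled for \<open>0 < t < T\<close>, whereas
  \<open>t1 = 0\<close> and \<open>t2 = T\<close> are allowed.\<close>

lemma set_integral_Icc_cong_interior:
  fixes f g :: "real \<Rightarrow> real"
  assumes "\<And>t. a < t \<Longrightarrow> t < b \<Longrightarrow> f t = g t"
  shows "(LINT t:{a..b}|lborel. f t) = (LINT t:{a..b}|lborel. g t)"
proof -
  have *: "(LINT t:{a..b}|lborel. h t) = (LINT t:{a<..<b}|lborel. h t)" for h :: "real \<Rightarrow> real"
    by (rule set_integral_discrete_difference[where X = "{a, b}"]) auto
  show ?thesis unfolding * using assms by (intro set_lebesgue_integral_cong) auto
qed

section \<open>Product rules, extended derivatives and the coefficient functions\<close>

lemma has_real_derivative_inner:
  fixes f g :: "real \<Rightarrow> 'a::real_inner"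
  assumes "(f has_vector_derivative f') (at t within S)" "(g has_vector_derivative g') (at t within S)"
  shows "((\<lambda>s. f s \<bullet> g s) has_real_derivative f' \<bullet> g t + f t \<bullet> g') (at t within S)"
  using bounded_bilinear.has_vector_derivative[OF bounded_bilinear_inner assms]
  by (simp add: has_real_derivative_iff_has_vector_derivative add.commute)

lemma has_real_derivative_norm_sq:
  fixes f :: "real \<Rightarrow> 'a::real_inner"
  assumes "(f has_vector_derivative f') (at t within S)"
  shows "((\<lambda>s. (norm (f s))\<^sup>2) has_real_derivative 2 * (f t \<bullet> f')) (at t within S)"
  using has_real_derivative_inner[OF assms assms]
  by (simp add: power2_norm_eq_inner inner_commute)

text \<open>Replaces the nested existentials by functions of the direction. The index order is that
  of differentiation: \<open>H b c\<close> is the \<open>c\<close>-derivative of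
  \<open>G b\<close>.\<close>

lemma Ck_closure_2E:
  assumes "Ck_closure 2 S f"
  obtains G H where
    "\<And>b. b \<in> Basis \<Longrightarrow> continuous_on (closure S) (G b)"
    "\<And>b x. b \<in> Basis \<Longrightarrow> x \<in> S \<Longrightarrow> ((\<lambda>h. f (x + h *\<^sub>R b)) has_vector_derivative G b x) (at 0)"
    "\<And>b c. b \<in> Basis \<Longrightarrow> c \<in> Basis \<Longrightarrow> continuous_on (closure S) (H b c)"
    "\<And>b c x. b \<in> Basis \<Longrightarrow> c \<in> Basis \<Longrightarrow> x \<in> S \<Longrightarrow>
       ((\<lambda>h. G b (x + h *\<^sub>R c)) has_vector_derivative H b c x) (at 0)"
proof -
  have "\<forall>b\<in>Basis. \<exists>g. (\<forall>x\<in>S. ((\<lambda>h. f (x + h *\<^sub>R b)) has_vector_derivative g x) (at 0)) \<and>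
      Ck_closure (Suc 0) S g"
    using assms by (simp add: numeral_2_eq_2)
  then obtain G where G: "\<forall>b\<in>Basis. (\<forall>x\<in>S. ((\<lambda>h. f (x + h *\<^sub>R b)) has_vector_derivative G b x) (at 0)) \<and>
      Ck_closure (Suc 0) S (G b)"
    by metis
  then have "\<forall>b\<in>Basis. \<forall>c\<in>Basis. \<exists>g. (\<forall>x\<in>S. ((\<lambda>h. G b (x + h *\<^sub>R c)) has_vector_derivative g x) (at 0)) \<and>
      continuous_on (closure S) g"
    by simp
  then obtain H where "\<forall>b\<in>Basis. \<forall>c\<in>Basis. (\<forall>x\<in>S. ((\<lambda>h. G b (x + h *\<^sub>R c)) has_vector_derivative H b c x) (at 0)) \<and>
      continuous_on (closure S) (H b c)"
    by metis
  with G show ?thesis by (intro that[of G H]) auto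
qed

text \<open>The only basis vector of \<open>real\<close> is \<open>1\<close> and the domain is the
  whole line, so the extended derivative in \<open>Ck_closure\<close> is the ordinary one.\<close>

lemma
  assumes "gl_cutoff chi"
  shows gl_cutoff_has_derivative: "(chi has_real_derivative deriv chi s) (at s)"
    and gl_cutoff_continuous_deriv: "continuous_on UNIV (deriv chi)"
proof -
  have "Ck_closure (Suc 0) UNIV chi"
    using assms unfolding gl_cutoff_def smooth_closure_def by blast
  then obtain g where g: "\<And>x. ((\<lambda>h. chi (x + h)) has_vector_derivative g x) (at 0)" "continuous_on UNIV g"
    by auto
  have D: "(chi has_real_derivative g x) (at x)" for x
    using directional_derivative_shift[of chi 0 x 1 "g x"] g(1)[of x]
    by (simp add: has_real_derivative_iff_has_vector_derivative)
  then have "deriv chi = g" by (auto intro: DERIV_imp_deriv)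
  with D g(2) show "(chi has_real_derivative deriv chi s) (at s)" "continuous_on UNIV (deriv chi)"
    by auto
qed

lemma has_real_derivative_kappa: "(kappa has_real_derivative inverse (1 + t\<^sup>2) / pi) (at t)"
  unfolding kappa_def[abs_def] by (auto intro!: derivative_eq_intros)

lemma deriv_kappa: "deriv kappa t = inverse (1 + t\<^sup>2) / pi"
  by (rule DERIV_imp_deriv[OF has_real_derivative_kappa])

section \<open>Slices of the space-time cylinder and its lateral boundary\<close>

lemma closure_cyl: "T > 0 \<Longrightarrow> closure (cyl T :: (real \<times> (real ^ 'd::finite)) set) = {0..T} \<times> cball 0 1"
  by (simp add: cyl_def closure_Times)

lemma open_cyl: "open (cyl T)" and convex_cyl: "convex (cyl T)"
  unfolding cyl_def by (auto intro!: open_Times convex_Times)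

lemma open_line_preimage:
  fixes x b :: "'a::real_normed_vector"
  assumes "open S"
  shows "open {h. x + h *\<^sub>R b \<in> S}"
  using open_vimage[OF assms, of "\<lambda>h. x + h *\<^sub>R b"]
  by (simp add: vimage_def continuous_intros)

lemma partial_eqI:
  assumes "((\<lambda>h. f (x + h *\<^sub>R axis i 1)) has_vector_derivative v) (at 0)"
  shows "partial i f x = v"
  unfolding partial_def using assms by (rule vector_derivative_at)

lemma time_slice_derivative:
  assumes "((\<lambda>h. f ((t, x) + h *\<^sub>R (1, 0))) has_vector_derivative v) (at 0)"
  shows "((\<lambda>s. f (s, x)) has_vector_derivative v) (at t)"
  using directional_derivative_shift[of f "(0, x)" t "(1, 0)" v] assms by simp

text \<open>At \<open>t = 0\<close> and \<open>t = T\<close> the slice lies on the frontier of the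
  cylinder, where the closure version of the derivative is needed. For \<open>x\<close> in the open
  ball, all small \<open>h\<close> of either sign remain admissible, which makes the derivative
  two-sided.\<close>

lemma space_slice_partial_closure:
  fixes f g :: "real \<times> (real ^ 'd::finite) \<Rightarrow> 'b::real_normed_vector"
  assumes T: "T > 0"
    and "continuous_on (closure (cyl T)) f" "continuous_on (closure (cyl T)) g"
    and "\<And>z. z \<in> cyl T \<Longrightarrow> ((\<lambda>h. f (z + h *\<^sub>R (0, axis i 1))) has_vector_derivative g z) (at 0)"
    and t: "t \<in> {0..T}" and x: "x \<in> ball 0 1"
  shows "((\<lambda>h. f (t, x + h *\<^sub>R axis i 1)) has_vector_derivative g (t, x)) (at 0)"
proof -
  let ?B = "{h. x + h *\<^sub>R axis i 1 \<in> ball 0 1}"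
  have ne: "cyl T \<noteq> ({} :: (real \<times> (real ^ 'd)) set)" using T by (simp add: cyl_def)
  have "((\<lambda>h. f ((t, x) + h *\<^sub>R (0, axis i 1))) has_vector_derivative g (t, x))
      (at 0 within {h. (t, x) + h *\<^sub>R (0, axis i 1) \<in> closure (cyl T)})"
    by (rule directional_derivative_closure[OF open_cyl convex_cyl ne assms(2-4)])
       (use t x T in \<open>auto simp: closure_cyl\<close>)
  then have "((\<lambda>h. f ((t, x) + h *\<^sub>R (0, axis i 1))) has_vector_derivative g (t, x)) (at 0 within ?B)"
    by (rule has_vector_derivative_within_subset) (use t T in \<open>auto simp: closure_cyl\<close>)
  moreover have "at 0 within ?B = at 0"
    using x by (intro at_within_open open_line_preimage) auto
  ultimately show ?thesis by simp
qed

text \<open>At interior times the extended derivative is still a two-sided time derivative on the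
  lateral boundary, and the time-independent boundary values make it zero.\<close>

lemma time_derivative_lateral_boundary:
  fixes u ut :: "real \<times> (real ^ 'd::finite) \<Rightarrow> 'b::real_normed_vector"
  assumes u: "continuous_on (closure (cyl T)) u" and ut: "continuous_on (closure (cyl T)) ut"
    and D: "\<And>z. z \<in> cyl T \<Longrightarrow> ((\<lambda>h. u (z + h *\<^sub>R (1, 0))) has_vector_derivative ut z) (at 0)"
    and bdry: "\<And>s. s \<in> {0<..<T} \<Longrightarrow> u (s, x) = c"
    and t: "t \<in> {0<..<T}" and x: "x \<in> sphere 0 1"
  shows "ut (t, x) = 0"
proof -
  let ?B = "{- t<..<T - t}"
  have T: "T > 0" using t by auto
  have ne: "cyl T \<noteq> ({} :: (real \<times> (real ^ 'd)) set)" using T by (simp add: cyl_def)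
  have "((\<lambda>h. u ((t, x) + h *\<^sub>R (1, 0))) has_vector_derivative ut (t, x))
      (at 0 within {h. (t, x) + h *\<^sub>R (1, 0) \<in> closure (cyl T)})"
    by (rule directional_derivative_closure[OF open_cyl convex_cyl ne u ut D])
       (use t x T in \<open>auto simp: closure_cyl\<close>)
  then have "((\<lambda>h. u ((t, x) + h *\<^sub>R (1, 0))) has_vector_derivative ut (t, x)) (at 0 within ?B)"
    by (rule has_vector_derivative_within_subset) (use t x T in \<open>auto simp: closure_cyl\<close>)
  moreover have "at 0 within ?B = at 0" using t by (intro at_within_open) auto
  ultimately have "((\<lambda>h. u ((t, x) + h *\<^sub>R (1, 0))) has_vector_derivative ut (t, x)) (at 0)"
    by (simp only:)
  then have "((\<lambda>h. c) has_vector_derivative ut (t, x)) (at 0)"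
    by (rule has_vector_derivative_transform_within_open[where S = ?B])
       (use t in \<open>auto intro!: bdry\<close>)
  then show ?thesis
    using vector_derivative_unique_at[OF _ has_vector_derivative_const] by blast
qed

section \<open>Energy balance of the Ginzburg-Landau flow\<close>

theorem theorem2p5:
  fixes T lam t1 t2 :: real
    and D :: nat
    and chi :: "real \<Rightarrow> real"
    and u0 :: "real ^ 'd::finite \<Rightarrow> real ^ 'm::finite"
    and u :: "real \<times> (real ^ 'd) \<Rightarrow> real ^ 'm"
  assumes "CARD('d) \<ge> 2" and "D \<ge> 2" and "CARD('m) = D + 1"
    and "gl_cutoff chi"
    and "T > 0" and "lam > 0"
    and "classical_GLHF chi T lam u0 u"
    and "0 \<le> t1" and "t1 \<le> t2" and "t2 \<le> T"
  shows "(LINT t:{t1..t2}|lborel. (LINT x:ball 0 1|lborel. (norm (time_deriv u t x))\<^sup>2))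
       + (LINT x:ball 0 1|lborel. gl_energy chi lam u t2 x)
       + ln lam / 4 * (LINT t:{t1..t2}|lborel. deriv kappa t * lam powr (1 - kappa t)
             * (LINT x:ball 0 1|lborel. chi (((norm (u (t, x)))\<^sup>2 - 1)\<^sup>2)))
       = (LINT x:ball 0 1|lborel. gl_energy chi lam u t1 x)"
proof -
  note T = \<open>T > 0\<close> and lam = \<open>lam > 0\<close> and t12 = \<open>0 \<le> t1\<close> \<open>t1 \<le> t2\<close> \<open>t2 \<le> T\<close>
  let ?C = "cyl T :: (real \<times> (real ^ 'd)) set"
  let ?K = "{0..T} \<times> cball (0 :: real ^ 'd) 1"
  let ?B = "ball (0 :: real ^ 'd) 1"
  \<comment> \<open>\<open>G b\<close> and \<open>H b c\<close> below are the continuous extensions of \<open>\<partial>\<^sub>b u\<close> and \<open>\<partial>\<^sub>c \<partial>\<^sub>b u\<close>;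
    \<open>time_deriv u\<close> itself may be a junk value at the times \<open>0\<close> and \<open>T\<close>\<close>
  define et :: "real \<times> (real ^ 'd)" where "et = (1, 0)"
  define ex :: "'d \<Rightarrow> real \<times> (real ^ 'd)" where "ex = (\<lambda>i. (0, axis i 1))"
  have basis: "et \<in> Basis" "ex i \<in> Basis" for i
    by (auto simp: et_def ex_def Basis_prod_def axis_in_Basis_iff)
  have smooth: "smooth_closure ?C u"
    and pde: "\<And>t x. (t, x) \<in> ?C \<Longrightarrow>
        time_deriv u t x - laplacian (\<lambda>y. u (t, y)) x
        + (lam powr (1 - kappa t) * deriv chi (((norm (u (t, x)))\<^sup>2 - 1)\<^sup>2)
             * ((norm (u (t, x)))\<^sup>2 - 1)) *\<^sub>R u (t, x) = 0"
    and bdry: "\<And>t x. (t, x) \<in> cyl_bdry T \<Longrightarrow> u (t, x) = u0 x"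
    using assms(7) unfolding classical_GLHF_def by auto
  have Ck: "Ck_closure k ?C u" for k using smooth by (simp add: smooth_closure_def)
  have cu: "continuous_on (closure ?C) u" using Ck[of 0] by simp
  obtain G H where
    cG: "\<And>b. b \<in> Basis \<Longrightarrow> continuous_on (closure ?C) (G b)"
    and DG: "\<And>b x. b \<in> Basis \<Longrightarrow> x \<in> ?C \<Longrightarrow> ((\<lambda>h. u (x + h *\<^sub>R b)) has_vector_derivative G b x) (at 0)"
    and cH: "\<And>b c. b \<in> Basis \<Longrightarrow> c \<in> Basis \<Longrightarrow> continuous_on (closure ?C) (H b c)"
    and DH: "\<And>b c x. b \<in> Basis \<Longrightarrow> c \<in> Basis \<Longrightarrow> x \<in> ?C \<Longrightarrow>
       ((\<lambda>h. G b (x + h *\<^sub>R c)) has_vector_derivative H b c x) (at 0)"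
    using Ck_closure_2E[OF Ck[of 2]] by blast
  have cK: "continuous_on ?K u" "continuous_on ?K (G et)" "continuous_on ?K (G (ex i))"
    "continuous_on ?K (H (ex i) et)" for i
    using cu cG cH basis by (auto simp: closure_cyl[OF T, symmetric])
  have slice: "continuous_on (cball 0 1) (\<lambda>x. f (t, x))" if "continuous_on ?K f" "t \<in> {0..T}"
    for f :: "real \<times> (real ^ 'd) \<Rightarrow> 'c::topological_space" and t
    by (rule continuous_on_compose2[OF that(1)]) (use that(2) in \<open>auto intro!: continuous_intros\<close>)
  have in_C: "(t, x) \<in> ?C \<longleftrightarrow> t \<in> {0<..<T} \<and> x \<in> ?B" for t x
    by (auto simp: cyl_def)

  \<comment> \<open>Differentiating the energy in time produces \<open>H (ex i) et\<close>,
    differentiating \<open>G et\<close> in space produces \<open>H et (ex i)\<close>; the divergence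
    form needs them equal.\<close>
  have sym: "H et (ex i) z = H (ex i) et z" if "z \<in> ?C" for i z
    by (rule mixed_directional_derivatives_eq[OF open_cyl DG[OF basis(1)] DG[OF basis(2)]
          DH[OF basis(1,2)] DH[OF basis(2,1)] _ _ that])
       (use cH[OF basis(1,2)] cH[OF basis(2,1)] in \<open>auto intro: continuous_on_subset[OF _ closure_subset]\<close>)
  \<comment> \<open>The end times are included because the energy is evaluated at \<open>t1\<close>
    and \<open>t2\<close>, which may be \<open>0\<close> and \<open>T\<close>.\<close>
  have partial_u: "partial i (\<lambda>y. u (t, y)) x = G (ex i) (t, x)" if "t \<in> {0..T}" "x \<in> ?B" for i t x
    by (intro partial_eqI space_slice_partial_closure[OF T cu cG[OF basis(2)] _ that])
       (use DG[OF basis(2)] in \<open>simp add: ex_def\<close>)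
  have space_G: "((\<lambda>h. G b (t, x + h *\<^sub>R axis i 1)) has_vector_derivative H b (ex i) (t, x)) (at 0)"
    if "t \<in> {0<..<T}" "x \<in> ?B" "b \<in> Basis" for b i t x
    using DH[OF that(3) basis(2), of "(t, x)" i] that by (simp add: in_C ex_def)
  \<comment> \<open>The outer derivative needs the inner \<open>partial\<close> to agree with
    \<open>G (ex i)\<close> not just at \<open>x\<close> but along a short segment through
    it.\<close>
  have partial2_u: "partial i (partial i (\<lambda>y. u (t, y))) x = H (ex i) (ex i) (t, x)"
    if t: "t \<in> {0<..<T}" and x: "x \<in> ?B" for i t x
  proof (rule partial_eqI, rule has_vector_derivative_transform_within_open[OF space_G[OF t x basis(2)]])
    show "open {h. x + h *\<^sub>R axis i 1 \<in> ?B}"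
      by (intro open_line_preimage open_ball)
  qed (use t x partial_u in auto)
  have time_u: "((\<lambda>s. u (s, x)) has_vector_derivative G et (t, x)) (at t)"
    and time_G: "((\<lambda>s. G (ex i) (s, x)) has_vector_derivative H (ex i) et (t, x)) (at t)"
    if "t \<in> {0<..<T}" "x \<in> ?B" for i t x
    using DG[OF basis(1), of "(t, x)"] DH[OF basis(2) basis(1), of "(t, x)" i] that
    by (auto simp: in_C et_def intro!: time_slice_derivative)
  have time_deriv_u: "time_deriv u t x = G et (t, x)" if "t \<in> {0<..<T}" "x \<in> ?B" for t x
    unfolding time_deriv_def by (rule vector_derivative_at[OF time_u[OF that]])
  have lateral: "G et (t, x) = 0" if "t \<in> {0<..<T}" "x \<in> sphere 0 1" for t x
    by (rule time_derivative_lateral_boundary[OF cu cG[OF basis(1)] _ _ that, where c = "u0 x"])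
       (use DG[OF basis(1)] that(2) in \<open>auto simp: et_def cyl_bdry_def intro!: bdry\<close>)

  define L where "L = (\<lambda>t. lam powr (1 - kappa t))"
  define X where "X = (\<lambda>z. chi (((norm (u z))\<^sup>2 - 1)\<^sup>2))"
  define X' where "X' = (\<lambda>z. deriv chi (((norm (u z))\<^sup>2 - 1)\<^sup>2))"
  \<comment> \<open>\<open>E\<close> expresses the energy density through the extended derivatives,
    hence is continuous on the closed cylinder; \<open>k\<close> is its time derivative.\<close>
  define E where "E = (\<lambda>z. 1/2 * (\<Sum>i\<in>UNIV. (norm (G (ex i) z))\<^sup>2) + L (fst z) / 4 * X z)"
  define k where "k = (\<lambda>z. (\<Sum>i\<in>UNIV. G (ex i) z \<bullet> H (ex i) et z)
      - ln lam / 4 * (deriv kappa (fst z) * L (fst z) * X z)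
      + L (fst z) * X' z * ((norm (u z))\<^sup>2 - 1) * (u z \<bullet> G et z))"
  note chi_D = gl_cutoff_has_derivative[OF \<open>gl_cutoff chi\<close>]
  have c_chi: "continuous_on UNIV chi" using chi_D by (rule DERIV_continuous_on[OF has_field_derivative_at_within])
  have c_kappa: "continuous_on UNIV kappa"
    using has_real_derivative_kappa by (rule DERIV_continuous_on[OF has_field_derivative_at_within])
  have cL: "continuous_on S (\<lambda>z. L (f z))" if "continuous_on S f" for S and f :: "real \<times> (real ^ 'd) \<Rightarrow> real"
    unfolding L_def using lam by (auto intro!: continuous_intros continuous_on_compose2[OF c_kappa that])
  have ck': "continuous_on S (\<lambda>z. deriv kappa (f z))" if "continuous_on S f" for S and f :: "real \<times> (real ^ 'd) \<Rightarrow> real"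
    unfolding deriv_kappa using that
    by (auto intro!: continuous_intros simp: add_nonneg_eq_0_iff)
  have cX: "continuous_on ?K X" "continuous_on ?K X'"
    unfolding X_def X'_def
    by (auto intro!: continuous_on_compose2[OF c_chi]
          continuous_on_compose2[OF gl_cutoff_continuous_deriv[OF \<open>gl_cutoff chi\<close>]] continuous_intros cK)
  have cE: "continuous_on ?K E"
    unfolding E_def by (intro continuous_intros cK cL cX) auto
  have ck: "continuous_on ?K k"
    unfolding k_def by (intro continuous_intros cK cL cX ck') auto
  have energy: "gl_energy chi lam u t x = E (t, x)" if "t \<in> {0..T}" "x \<in> ?B" for t x
    using partial_u[OF that] by (simp add: gl_energy_def grad_norm_sq_def E_def L_def X_def)

  have E_deriv: "((\<lambda>s. E (s, x)) has_vector_derivative k (t, x)) (at t)"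
    if tx: "t \<in> {0<..<T}" "x \<in> ?B" for t x
  proof -
    \<comment> \<open>The minus sign stems from the exponent \<open>1 - kappa t\<close>; with the
      factor \<open>1/4\<close> in \<open>E\<close> this yields the \<open>ln lam / 4\<close>
      term.\<close>
    have "(L has_real_derivative - (ln lam * deriv kappa t * L t)) (at t)"
      unfolding L_def deriv_kappa using lam
      by (auto intro!: derivative_eq_intros has_real_derivative_kappa)
    moreover have "((\<lambda>s. (norm (u (s, x)))\<^sup>2 - 1) has_real_derivative 2 * (u (t, x) \<bullet> G et (t, x))) (at t)"
      using DERIV_diff[OF has_real_derivative_norm_sq[OF time_u[OF tx]] DERIV_const] by simp
    \<comment> \<open>The factors \<open>2\<close> from the two squares combine to \<open>4\<close>
      and cancel the \<open>1/4\<close> in \<open>E\<close>, leaving the nonlinear term of the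
      equation paired with \<open>G et\<close>.\<close>
    from DERIV_power[OF this, of 2] have "((\<lambda>s. ((norm (u (s, x)))\<^sup>2 - 1)\<^sup>2) has_real_derivative
        4 * (u (t, x) \<bullet> G et (t, x) * ((norm (u (t, x)))\<^sup>2 - 1))) (at t)"
      by (simp add: mult_ac)
    from DERIV_chain2[OF chi_D this] have "((\<lambda>s. X (s, x)) has_real_derivative
        X' (t, x) * (4 * (u (t, x) \<bullet> G et (t, x) * ((norm (u (t, x)))\<^sup>2 - 1)))) (at t)"
      by (simp add: X_def X'_def)
    ultimately have "((\<lambda>s. E (s, x)) has_real_derivative
        1/2 * (\<Sum>i\<in>UNIV. 2 * (G (ex i) (t, x) \<bullet> H (ex i) et (t, x)))
        + (- (ln lam * deriv kappa t * L t) / 4 * X (t, x)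
          + X' (t, x) * (4 * (u (t, x) \<bullet> G et (t, x) * ((norm (u (t, x)))\<^sup>2 - 1))) * (L t / 4))) (at t)"
      unfolding E_def fst_conv
      by (intro DERIV_add DERIV_cmult DERIV_mult DERIV_sum DERIV_cdivide
          has_real_derivative_norm_sq[OF time_G[OF tx]])
    then show ?thesis
      by (simp add: has_real_derivative_iff_has_vector_derivative k_def sum_distrib_left[symmetric] algebra_simps)
  qed

  \<comment> \<open>The fundamental theorem is used with differentiability at interior times and
    continuity up to the ends, which covers \<open>t1 = 0\<close> and \<open>t2 = T\<close>.\<close>
  have E_diff: "(LINT t:{t1..t2}|lborel. k (t, x)) = E (t2, x) - E (t1, x)" if x: "x \<in> ?B" for x
  proof -
    have sl: "continuous_on {t1..t2} (\<lambda>t. f (t, x))" if "continuous_on ?K f" for f :: "_ \<Rightarrow> real"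
      by (rule continuous_on_compose2[OF that]) (use x t12 in \<open>auto intro!: continuous_intros\<close>)
    have "((\<lambda>t. k (t, x)) has_integral E (t2, x) - E (t1, x)) {t1..t2}"
      by (rule fundamental_theorem_of_calculus_interior)
         (use t12 x in \<open>auto intro!: sl cE E_deriv\<close>)
    moreover have "set_integrable lborel {t1..t2} (\<lambda>t. k (t, x))"
      by (intro borel_integrable_atLeastAtMost' sl ck)
    ultimately show ?thesis
      by (simp add: set_borel_integral_eq_integral integral_unique)
  qed

  \<comment> \<open>By the symmetry of mixed derivatives, the integrand is the derivative of
    \<open>G et \<bullet> G (ex i)\<close> along \<open>axis i 1\<close>; on the sphere this product
    vanishes because of its factor \<open>G et\<close>.\<close>
  have divergence: "(LINT x:?B|lborel. H (ex i) et (t, x) \<bullet> G (ex i) (t, x)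
        + G et (t, x) \<bullet> H (ex i) (ex i) (t, x)) = 0"
    and divergence_int: "set_integrable lborel ?B (\<lambda>x. H (ex i) et (t, x) \<bullet> G (ex i) (t, x)
        + G et (t, x) \<bullet> H (ex i) (ex i) (t, x))"
    if t: "t \<in> {0<..<T}" for i t
  proof -
    let ?g = "\<lambda>x. H (ex i) et (t, x) \<bullet> G (ex i) (t, x) + G et (t, x) \<bullet> H (ex i) (ex i) (t, x)"
    have cR: "continuous_on ?K (H (ex i) (ex i))"
      using cH basis by (auto simp: closure_cyl[OF T, symmetric])
    have cg: "continuous_on (closure ?B) ?g"
      using t by (auto intro!: continuous_intros slice cK cR)
    show "(LINT x:?B|lborel. ?g x) = 0"
    proof (rule integral_directional_derivative_eq_0[where f = "\<lambda>x. G et (t, x) \<bullet> G (ex i) (t, x)" and b = "axis i 1"])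
      show "continuous_on (closure ?B) (\<lambda>x. G et (t, x) \<bullet> G (ex i) (t, x))"
        using t by (auto intro!: continuous_intros slice cK)
      fix x assume x: "x \<in> ?B"
      show "((\<lambda>h. G et (t, x + h *\<^sub>R axis i 1) \<bullet> G (ex i) (t, x + h *\<^sub>R axis i 1))
          has_vector_derivative ?g x) (at 0)"
        using has_real_derivative_inner[OF space_G[OF t x basis(1)] space_G[OF t x basis(2)]] sym t x
        by (simp add: has_real_derivative_iff_has_vector_derivative in_C)
    qed (use cg lateral[OF t] in auto)
    show "set_integrable lborel ?B ?g"
      by (intro set_integrable_continuous_closure cg) auto
  qed

  have k_eq: "k (t, x) = (\<Sum>i\<in>UNIV. H (ex i) et (t, x) \<bullet> G (ex i) (t, x)
        + G et (t, x) \<bullet> H (ex i) (ex i) (t, x))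
      - (norm (G et (t, x)))\<^sup>2 - ln lam / 4 * (deriv kappa t * L t * X (t, x))"
    if tx: "t \<in> {0<..<T}" "x \<in> ?B" for t x
  proof -
    have "laplacian (\<lambda>y. u (t, y)) x = (\<Sum>i\<in>UNIV. H (ex i) (ex i) (t, x))"
      unfolding laplacian_def by (simp add: partial2_u[OF tx])
    then have "G et (t, x) - (\<Sum>i\<in>UNIV. H (ex i) (ex i) (t, x))
        + (L t * X' (t, x) * ((norm (u (t, x)))\<^sup>2 - 1)) *\<^sub>R u (t, x) = 0"
      using pde[of t x] tx time_deriv_u[OF tx] by (simp add: in_C L_def X'_def)
    \<comment> \<open>Testing the equation with the time derivative turns the nonlinear term of
      \<open>k\<close> into the Laplacian paired with \<open>G et\<close> minus the dissipation; the
      gradient terms complete the former to a divergence.\<close>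
    then have "G et (t, x) \<bullet> (G et (t, x) - (\<Sum>i\<in>UNIV. H (ex i) (ex i) (t, x))
        + (L t * X' (t, x) * ((norm (u (t, x)))\<^sup>2 - 1)) *\<^sub>R u (t, x)) = 0"
      by simp
    then have "L t * X' (t, x) * ((norm (u (t, x)))\<^sup>2 - 1) * (u (t, x) \<bullet> G et (t, x))
        = (\<Sum>i\<in>UNIV. G et (t, x) \<bullet> H (ex i) (ex i) (t, x)) - (norm (G et (t, x)))\<^sup>2"
      by (simp add: inner_add_right inner_diff_right inner_sum_right power2_norm_eq_inner
          inner_commute[of "u (t, x)" "G et (t, x)"])
    then show ?thesis
      by (simp add: k_def sum.distrib inner_commute)
  qed

  define V where "V = (\<lambda>t. LINT x:?B|lborel. (norm (G et (t, x)))\<^sup>2)"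
  \<comment> \<open>The time factor stays under the integral so that the integrand is continuous on
    the closed cylinder and \<open>Fubini_cylinder\<close> provides integrability in time.\<close>
  define W where "W = (\<lambda>t. LINT x:?B|lborel. deriv kappa t * L t * X (t, x))"
  have k_int: "(LINT x:?B|lborel. k (t, x)) = - V t - ln lam / 4 * W t" if t: "t \<in> {0<..<T}" for t
  proof -
    let ?d = "\<lambda>i x. H (ex i) et (t, x) \<bullet> G (ex i) (t, x) + G et (t, x) \<bullet> H (ex i) (ex i) (t, x)"
    have 1: "set_integrable lborel ?B (\<lambda>x. \<Sum>i\<in>UNIV. ?d i x)"
      using divergence_int[OF t] unfolding set_integrable_def scaleR_sum_right
      by (intro Bochner_Integration.integrable_sum)
    have 2: "(LINT x:?B|lborel. \<Sum>i\<in>UNIV. ?d i x) = 0"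
      using divergence_int[OF t] divergence[OF t]
      unfolding set_integrable_def set_lebesgue_integral_def scaleR_sum_right
      by (subst Bochner_Integration.integral_sum) auto
    have 3: "set_integrable lborel ?B (\<lambda>x. (norm (G et (t, x)))\<^sup>2)"
      "set_integrable lborel ?B (\<lambda>x. ln lam / 4 * (deriv kappa t * L t * X (t, x)))"
      using t by (auto intro!: set_integrable_continuous_closure continuous_intros slice cK cX)
    have "(LINT x:?B|lborel. k (t, x)) = (LINT x:?B|lborel. (\<Sum>i\<in>UNIV. ?d i x)
        - (norm (G et (t, x)))\<^sup>2 - ln lam / 4 * (deriv kappa t * L t * X (t, x)))"
      using k_eq[OF t] by (intro set_lebesgue_integral_cong) auto
    also have "\<dots> = 0 - V t - (LINT x:?B|lborel. ln lam / 4 * (deriv kappa t * L t * X (t, x)))"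
      using 1 2 3 by (simp add: V_def)
    finally show ?thesis by (simp only: set_integral_mult_right W_def diff_0)
  qed

  have sub: "continuous_on ({t1..t2} \<times> closure ?B) f" if "continuous_on ?K f" for f :: "_ \<Rightarrow> real"
    by (rule continuous_on_subset[OF that]) (use t12 in auto)
  have cV: "continuous_on ?K (\<lambda>z. (norm (G et z))\<^sup>2)"
    and cW: "continuous_on ?K (\<lambda>z. deriv kappa (fst z) * L (fst z) * X z)"
    by (intro continuous_intros cK cL ck' cX)+
  have VW: "set_integrable lborel {t1..t2} V" "set_integrable lborel {t1..t2} W"
    using Fubini_cylinder(2)[OF open_ball bounded_ball sub[OF cV]]
      Fubini_cylinder(2)[OF open_ball bounded_ball sub[OF cW]]
    by (simp_all add: V_def W_def)
  have intE: "set_integrable lborel ?B (\<lambda>x. E (t, x))" if "t \<in> {0..T}" for t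
    using that by (auto intro!: set_integrable_continuous_closure slice cE)
  have E_int: "(LINT x:?B|lborel. gl_energy chi lam u t x) = (LINT x:?B|lborel. E (t, x))"
    if "t \<in> {0..T}" for t
    using energy[OF that] by (intro set_lebesgue_integral_cong) auto
  \<comment> \<open>One order of integration of \<open>k\<close> gives the energy difference, the
    other the dissipation and the \<open>ln lam\<close> term.\<close>
  have "(LINT x:?B|lborel. E (t2, x)) - (LINT x:?B|lborel. E (t1, x))
      = (LINT x:?B|lborel. E (t2, x) - E (t1, x))"
    using t12 by (intro set_integral_diff(2)[symmetric] intE) auto
  also have "\<dots> = (LINT x:?B|lborel. LINT t:{t1..t2}|lborel. k (t, x))"
    using E_diff by (intro set_lebesgue_integral_cong) auto
  also have "\<dots> = (LINT t:{t1..t2}|lborel. LINT x:?B|lborel. k (t, x))"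
    by (rule Fubini_cylinder(1)[OF open_ball bounded_ball sub[OF ck]])
  also have "\<dots> = (LINT t:{t1..t2}|lborel. - V t - ln lam / 4 * W t)"
    using t12 by (intro set_integral_Icc_cong_interior k_int) auto
  also have "\<dots> = - (LINT t:{t1..t2}|lborel. V t) - ln lam / 4 * (LINT t:{t1..t2}|lborel. W t)"
    using set_integral_diff(2)[OF set_integrable_mult_right[of "-1"] set_integrable_mult_right[of "ln lam / 4"],
        OF VW]
    by (simp only: set_integral_mult_right mult_minus1 set_integral_uminus[OF VW(1)])
  finally have main: "(LINT x:?B|lborel. E (t2, x)) - (LINT x:?B|lborel. E (t1, x))
      = - (LINT t:{t1..t2}|lborel. V t) - ln lam / 4 * (LINT t:{t1..t2}|lborel. W t)" .
  have "(LINT t:{t1..t2}|lborel. (LINT x:?B|lborel. (norm (time_deriv u t x))\<^sup>2))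
      = (LINT t:{t1..t2}|lborel. V t)"
    unfolding V_def using t12 time_deriv_u
    by (intro set_integral_Icc_cong_interior set_lebesgue_integral_cong) auto
  moreover have "deriv kappa t * lam powr (1 - kappa t)
      * (LINT x:?B|lborel. chi (((norm (u (t, x)))\<^sup>2 - 1)\<^sup>2)) = W t" for t
    by (simp add: W_def L_def X_def)
  ultimately show ?thesis
    using main t12 by (simp add: E_int)
qed

end
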